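(* Let $(\eta(t))_{t\in\mathbb{Z}_+}$ be the nonlinear process and assume $\mathbb{E}(\eta(0))=r\in[0,1)$ and $\mathbb{E}(e^{\lambda\eta(0)})<+\infty$ for some $\lambda>0$. Then $\eta(t)$ converges in distribution to $\pi_{\rho_r}$ as $t\to+\infty$, where $\rho_r:=1+r-\sqrt{1+r^2}$.
   Context: The nonlinear process $(\eta(t))_{t\in\mathbb{Z}_+}$ takes values in $\mathbb{Z}_+$: $\eta(0)$ has a given distribution; given $\eta(t)$, set $\rho(t):=\mathbb{P}(\eta(t)>0)$, let $N_{t+1}$ be Poisson with mean $\rho(t)$ (mean $0$ meaning identically $0$), independent of everything before, and set $\eta(t+1):=\eta(t)-\mathbf{1}(\eta(t)>0)+N_{t+1}$. The M/D/1 queue with arrival rate $\rho\ge 0$ is the Markov chain on $\mathbb{Z}_+$ given by $\zeta(t+1):=\zeta(t)-\mathbf{1}(\zeta(t)>0)+M_{t+1}$ with $(M_t)_{t\ge1}$ i.i.d. Poisson of mean $\rho$. For $\rho\in[0,1)$ it is positive recurrent, and $\pi_\rho$ denotes its invariant probability measure on $\mathbb{Z}_+$; its characteristic function is $\hat\pi_\rho(x)=\frac{(1-\rho)(e^{ix}-1)\exp\{\rho(e^{ix}-1)\}}{e^{ix}-\exp\{\rho(e^{ix}-1)\}}$, and for $r\ge0$ the measure $\pi_{\rho_r}$ with $\rho_r=1+r-\sqrt{1+r^2}$ has mean $r$. *)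

theory Defs
  imports "HOL-Probability.Probability"
begin

definition pois :: "real \<Rightarrow> nat pmf" where
  "pois rho = (if 0 < rho then poisson_pmf rho else return_pmf 0)"

text \<open>One step of a queue with service one per unit time and Poisson(rho) arrivals:
  law of  x - 1(x>0) + N  with N ~ Poisson(rho) independent of x ~ mu.
  Note that on nat, x - 1 is exactly x - 1(x>0).\<close>
definition queue_step :: "real \<Rightarrow> nat pmf \<Rightarrow> nat pmf" where
  "queue_step rho mu = bind_pmf mu (\<lambda>x. map_pmf (\<lambda>n. x - 1 + n) (pois rho))"

fun nl_law :: "nat pmf \<Rightarrow> nat \<Rightarrow> nat pmf" where
  "nl_law mu0 0 = mu0"
| "nl_law mu0 (Suc t) =
     queue_step (measure_pmf.prob (nl_law mu0 t) {x. 0 < x}) (nl_law mu0 t)"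

text \<open>Invariant probability measure of the M/D/1 queue with arrival rate rho
  (unique for rho in [0,1)).\<close>
definition MD1_inv :: "real \<Rightarrow> nat pmf" where
  "MD1_inv rho = (THE pi. queue_step rho pi = pi)"

definition rho_of :: "real \<Rightarrow> real" where
  "rho_of r = 1 + r - sqrt (1 + r^2)"

end

theory Submission
  imports Defs
begin

text \<open>
  Write \<open>\<rho>\<^sub>t\<close> for the probability that the process is nonzero at time \<open>t\<close>. The mean \<open>r\<close> is conserved and the
  second moment changes by \<open>- h(\<rho>\<^sub>t)\<close> in one step, where \<open>h(y) = y\<^sup>2 - 2(1 + r)y + 2r\<close> has \<open>\<rho>\<^sub>r\<close> as its only
  root in \<open>[0,1)\<close>. Since \<open>\<rho>\<^sub>t \<le> r < 1\<close>, exponential moments, hence second moments, are bounded in time.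

  Let \<open>q\<close> be the upper or lower limit of \<open>\<rho>\<^sub>t\<close>. If \<open>f\<^sub>n(x)\<close> is the probability that the M/D/1 queue with
  rate \<open>q\<close> started at \<open>x\<close> is empty at time \<open>n\<close>, then \<open>f\<^sub>n \<rightarrow> 1 - q\<close>, and the mean of \<open>f\<^sub>n\<close> at time \<open>t - n\<close>
  compares, monotonically in the arrival rates, with the probability \<open>1 - \<rho>\<^sub>t\<close> of being empty at time
  \<open>t\<close>. Near-extremality of \<open>\<rho>\<^sub>t\<close> therefore forces near-extremality of the preceding \<open>\<rho>\<^sub>t\<^sub>-\<^sub>1\<close>, so \<open>\<rho>\<close>
  stays close to \<open>q\<close> on arbitrarily long time intervals. Boundedness of the second moment gives
  \<open>h(q) = 0\<close>, that is \<open>q = \<rho>\<^sub>r\<close>, and so \<open>\<rho>\<^sub>t \<rightarrow> \<rho>\<^sub>r\<close>. The one-step recursion expresses the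
  probability of \<open>k + 1\<close> through those of \<open>0, \<dots>, k\<close>, so all point probabilities converge; the limit is
  tight and invariant.
\<close>

section \<open>Poisson arrivals\<close>

lemma pmf_pois: "pmf (pois a) k = a ^ k / fact k * exp (- a)" if "0 \<le> a"
  using that by (cases k) (auto simp: pois_def)

lemma nat_pmf_expectation_sums:
  fixes p :: "nat pmf" and f :: "nat \<Rightarrow> real"
  assumes "\<And>n. 0 \<le> f n" and sums: "(\<lambda>n. pmf p n * f n) sums s"
  shows "integrable (measure_pmf p) f" "measure_pmf.expectation p f = s"
proof -
  have "(\<integral>\<^sup>+ n. ennreal (f n) \<partial>measure_pmf p) = (\<Sum>n. ennreal (pmf p n * f n))"
    by (simp add: nn_integral_measure_pmf nn_integral_count_space_nat assms ennreal_mult)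
  also have "\<dots> = ennreal s"
    by (rule suminf_ennreal_eq[OF _ sums]) (simp add: assms(1))
  finally have *: "(\<integral>\<^sup>+ n. ennreal (f n) \<partial>measure_pmf p) = ennreal s" .
  have "0 \<le> s"
    using sums by (rule sums_le[OF _ sums_zero, rotated]) (simp add: assms(1))
  then have "has_bochner_integral (measure_pmf p) f s"
    using * assms(1) by (intro has_bochner_integral_nn_integral) auto
  then show "integrable (measure_pmf p) f" "measure_pmf.expectation p f = s"
    by (auto simp: has_bochner_integral_iff)
qed

lemma pois_power:
  assumes "0 \<le> a" "0 \<le> z"
  shows integrable_pois_power: "integrable (measure_pmf (pois a)) (\<lambda>n. z ^ n)"
    and expectation_pois_power: "measure_pmf.expectation (pois a) (\<lambda>n. z ^ n) = exp (a * (z - 1))"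
proof -
  have "(\<lambda>n. ((a * z) ^ n /\<^sub>R fact n) * exp (- a)) sums (exp (a * z) * exp (- a))"
    by (intro sums_mult2 exp_converges)
  also have "(\<lambda>n. ((a * z) ^ n /\<^sub>R fact n) * exp (- a)) = (\<lambda>n. pmf (pois a) n * z ^ n)"
    using assms by (simp add: pmf_pois power_mult_distrib field_simps)
  also have "exp (a * z) * exp (- a) = exp (a * (z - 1))"
    by (simp flip: exp_add add: algebra_simps)
  finally have "(\<lambda>n. pmf (pois a) n * z ^ n) sums exp (a * (z - 1))" .
  from nat_pmf_expectation_sums[OF _ this] assms
  show "integrable (measure_pmf (pois a)) (\<lambda>n. z ^ n)"
    "measure_pmf.expectation (pois a) (\<lambda>n. z ^ n) = exp (a * (z - 1))" by auto
qed

lemma sums_pmf_pois: "0 \<le> a \<Longrightarrow> pmf (pois a) sums 1"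
proof -
  assume a: "0 \<le> a"
  have "(\<lambda>n. (a ^ n /\<^sub>R fact n) * exp (- a)) sums (exp a * exp (- a))"
    by (intro sums_mult2 exp_converges)
  moreover have "exp a * exp (- a) = 1" by (simp flip: exp_add)
  moreover have "pmf (pois a) = (\<lambda>n. (a ^ n /\<^sub>R fact n) * exp (- a))"
    using a by (simp add: pmf_pois fun_eq_iff field_simps)
  ultimately show ?thesis by simp
qed

lemma pmf_pois_Suc: "0 \<le> a \<Longrightarrow> pmf (pois a) (Suc n) * real (Suc n) = a * pmf (pois a) n"
  by (simp add: pmf_pois field_simps del: of_nat_Suc)

lemma expectation_pois_id:
  assumes "0 \<le> a"
  shows "measure_pmf.expectation (pois a) real = a"
proof -
  have "(\<lambda>n. pmf (pois a) (Suc n) * real (Suc n)) sums (a * 1)"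
    unfolding pmf_pois_Suc[OF assms] by (intro sums_mult sums_pmf_pois assms)
  then have "(\<lambda>n. pmf (pois a) n * real n) sums a" by (subst (asm) sums_Suc_iff) simp
  then show ?thesis by (intro nat_pmf_expectation_sums) auto
qed

lemma expectation_pois_square:
  assumes "0 \<le> a"
  shows "measure_pmf.expectation (pois a) (\<lambda>n. (real n)\<^sup>2) = a\<^sup>2 + a"
proof -
  have "(\<lambda>n. pmf (pois a) (Suc n) * real (Suc n)) sums (a * 1)"
    unfolding pmf_pois_Suc[OF assms] by (intro sums_mult sums_pmf_pois assms)
  then have "(\<lambda>n. pmf (pois a) n * real n) sums a" by (subst (asm) sums_Suc_iff) simp
  then have "(\<lambda>n. a * (pmf (pois a) n * real n + pmf (pois a) n)) sums (a * (a + 1))"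
    by (intro sums_mult sums_add sums_pmf_pois assms)
  also have "(\<lambda>n. a * (pmf (pois a) n * real n + pmf (pois a) n)) =
      (\<lambda>n. pmf (pois a) (Suc n) * (real (Suc n))\<^sup>2)"
  proof
    fix n
    have "pmf (pois a) (Suc n) * (real (Suc n))\<^sup>2 = (pmf (pois a) (Suc n) * real (Suc n)) * (real n + 1)"
      by (simp add: power2_eq_square)
    then show "a * (pmf (pois a) n * real n + pmf (pois a) n) = pmf (pois a) (Suc n) * (real (Suc n))\<^sup>2"
      unfolding pmf_pois_Suc[OF assms] by (simp add: algebra_simps)
  qed
  finally have "(\<lambda>n. pmf (pois a) n * (real n)\<^sup>2) sums (a\<^sup>2 + a)"
    by (subst (asm) sums_Suc_iff) (simp add: algebra_simps power2_eq_square)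
  then show ?thesis by (intro nat_pmf_expectation_sums) auto
qed

lemma pmf_map_plus: "pmf (map_pmf ((+) m) p) k = (if m \<le> k then pmf p (k - m) else 0)" for m k :: nat
proof (cases "m \<le> k")
  case True
  then have "pmf (map_pmf ((+) m) p) (m + (k - m)) = pmf p (k - m)"
    by (intro pmf_map_inj') (auto simp: inj_def)
  with True show ?thesis by simp
next
  case False
  then have "k \<notin> set_pmf (map_pmf ((+) m) p)" by auto
  with False show ?thesis by (simp add: pmf_eq_0_set_pmf)
qed

lemma pois_add:
  assumes "0 \<le> a" "0 \<le> b"
  shows "pois (a + b) = bind_pmf (pois a) (\<lambda>n. map_pmf ((+) n) (pois b))"
proof (rule pmf_eqI)
  fix k
  have "pmf (bind_pmf (pois a) (\<lambda>n. map_pmf ((+) n) (pois b))) k =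
      (\<Sum>n\<le>k. pmf (pois a) n * pmf (pois b) (k - n))"
    unfolding pmf_bind pmf_map_plus by (subst integral_measure_pmf[of "{..k}"]) (auto split: if_splits)
  also have "\<dots> = (\<Sum>n\<le>k. (a ^ n /\<^sub>R fact n) * (b ^ (k - n) /\<^sub>R fact (k - n))) * exp (- (a + b))"
    unfolding sum_distrib_right using assms
    by (intro sum.cong refl) (simp add: pmf_pois exp_diff exp_minus field_simps)
  also have "\<dots> = (a + b) ^ k /\<^sub>R fact k * exp (- (a + b))"
    by (subst exp_series_add_commuting) (auto simp: mult.commute)
  also have "\<dots> = pmf (pois (a + b)) k"
    using assms by (simp add: pmf_pois field_simps)
  finally show "pmf (pois (a + b)) k = pmf (bind_pmf (pois a) (\<lambda>n. map_pmf ((+) n) (pois b))) k" by simp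
qed

section \<open>The transition operator\<close>

text \<open>A class of functions containing the identity and the square, closed under the transition operator, on
  which all expectations below exist.\<close>

definition exp_dom :: "real \<Rightarrow> (nat \<Rightarrow> real) \<Rightarrow> bool" where
  "exp_dom z f \<longleftrightarrow> (\<exists>C. \<forall>x. \<bar>f x\<bar> \<le> C * z ^ x)"

lemma exp_domI: "(\<And>x. \<bar>f x\<bar> \<le> C * z ^ x) \<Longrightarrow> exp_dom z f"
  by (auto simp: exp_dom_def)

lemma exp_dom_bounded:
  assumes "1 < z" "\<And>x. \<bar>f x\<bar> \<le> B"
  shows "exp_dom z f"
proof (rule exp_domI)
  fix x
  have "0 \<le> B" using assms(2)[of 0] by linarith
  then have "B * 1 \<le> B * z ^ x" using assms(1) by (intro mult_left_mono one_le_power) auto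
  with assms(2)[of x] show "\<bar>f x\<bar> \<le> B * z ^ x" by linarith
qed

lemma exp_dom_power: "1 < z \<Longrightarrow> exp_dom z (\<lambda>x. z ^ x)"
  by (rule exp_domI[where C = 1]) auto

lemma exp_dom_add:
  assumes "exp_dom z f" "exp_dom z g" shows "exp_dom z (\<lambda>x. f x + g x)"
proof -
  obtain C D where "\<And>x. \<bar>f x\<bar> \<le> C * z ^ x" "\<And>x. \<bar>g x\<bar> \<le> D * z ^ x"
    using assms by (auto simp: exp_dom_def)
  then show ?thesis
    by (intro exp_domI[where C = "C + D"]) (smt (verit) distrib_right)
qed

lemma exp_dom_cmult: "exp_dom z f \<Longrightarrow> exp_dom z (\<lambda>x. c * f x)"
proof -
  assume "exp_dom z f"
  then obtain C where C: "\<And>x. \<bar>f x\<bar> \<le> C * z ^ x" by (auto simp: exp_dom_def)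
  have "\<bar>c * f x\<bar> \<le> (\<bar>c\<bar> * C) * z ^ x" for x
    using mult_left_mono[OF C[of x], of "\<bar>c\<bar>"] by (simp add: abs_mult mult.assoc)
  then show ?thesis by (rule exp_domI)
qed

lemma exp_dom_sum: fixes n :: nat shows "1 < z \<Longrightarrow> (\<And>i. i < n \<Longrightarrow> exp_dom z (f i)) \<Longrightarrow> exp_dom z (\<lambda>x. \<Sum>i<n. f i x)"
  by (induction n) (auto intro: exp_dom_add exp_dom_bounded[where B = 0])

lemma exp_dom_id: "1 < z \<Longrightarrow> exp_dom z real"
proof (rule exp_domI[where C = "1 / (z - 1)"])
  fix x assume z: "1 < z"
  have "1 + real x * (z - 1) \<le> (1 + (z - 1)) ^ x"
    using z by (intro Bernoulli_inequality) auto
  with z show "\<bar>real x\<bar> \<le> 1 / (z - 1) * z ^ x" by (simp add: field_simps)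
qed

lemma exp_dom_square:
  assumes "1 < z" shows "exp_dom z (\<lambda>x. (real x)\<^sup>2)"
proof -
  have s: "1 < sqrt z" using assms by simp
  from exp_dom_id[OF this] obtain C where C: "\<And>x. \<bar>real x\<bar> \<le> C * sqrt z ^ x"
    by (auto simp: exp_dom_def)
  have "\<bar>(real x)\<^sup>2\<bar> \<le> C\<^sup>2 * z ^ x" for x
  proof -
    have "(real x)\<^sup>2 \<le> (C * sqrt z ^ x)\<^sup>2" using C[of x] by (intro power_mono) auto
    also have "\<dots> = C\<^sup>2 * ((sqrt z)\<^sup>2) ^ x" by (simp add: power_mult_distrib mult.commute flip: power_mult)
    finally show ?thesis using assms by simp
  qed
  then show ?thesis by (rule exp_domI)
qed

lemma exp_dom_integrable:
  assumes "exp_dom z f" "1 < z" "integrable (measure_pmf p) (\<lambda>x. z ^ x)"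
  shows "integrable (measure_pmf p) f"
proof -
  obtain C where C: "\<And>x. \<bar>f x\<bar> \<le> C * z ^ x" using assms by (auto simp: exp_dom_def)
  show ?thesis
  proof (rule Bochner_Integration.integrable_bound[where f = "\<lambda>x. C * z ^ x"])
    have "\<bar>f x\<bar> \<le> \<bar>C * z ^ x\<bar>" for x using C[of x] by linarith
    then show "AE x in measure_pmf p. norm (f x) \<le> norm (C * z ^ x)" by simp
  qed (use assms in auto)
qed

definition queue_op :: "real \<Rightarrow> (nat \<Rightarrow> real) \<Rightarrow> nat \<Rightarrow> real" where
  "queue_op a f x = measure_pmf.expectation (pois a) (\<lambda>n. f (x - 1 + n))"

lemma exp_dom_shift:
  assumes "exp_dom z f" "1 < z"
  shows "exp_dom z (\<lambda>n. f (k + n))"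
proof -
  obtain C where C: "\<And>x. \<bar>f x\<bar> \<le> C * z ^ x" using assms by (auto simp: exp_dom_def)
  show ?thesis using C[of "k + _"] by (intro exp_domI[where C = "C * z ^ k"]) (auto simp: power_add mult.assoc)
qed

lemma integrable_pois_exp_dom:
  assumes "exp_dom z f" "1 < z" "0 \<le> a"
  shows "integrable (measure_pmf (pois a)) (\<lambda>n. f (k + n))"
  by (rule exp_dom_integrable[OF exp_dom_shift[OF assms(1,2)] assms(2) integrable_pois_power])
    (use assms in auto)

lemma queue_op_add:
  assumes "exp_dom z f" "exp_dom z g" "1 < z" "0 \<le> a"
  shows "queue_op a (\<lambda>x. f x + g x) x = queue_op a f x + queue_op a g x"
  unfolding queue_op_def
  by (rule Bochner_Integration.integral_add[OF integrable_pois_exp_dom[OF assms(1)] integrable_pois_exp_dom[OF assms(2)]])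
    (use assms in auto)

lemma queue_op_cmult: "queue_op a (\<lambda>x. c * f x) x = c * queue_op a f x"
  by (simp add: queue_op_def)

lemma queue_op_const: "queue_op a (\<lambda>x. c) x = c"
  by (simp add: queue_op_def measure_pmf.prob_space)

lemma queue_op_sum:
  assumes "\<And>i. i < n \<Longrightarrow> exp_dom z (f i)" "1 < z" "0 \<le> a"
  shows "queue_op a (\<lambda>x. \<Sum>i<n. f i x) x = (\<Sum>i<n. queue_op a (f i) x)"
  unfolding queue_op_def
  by (rule Bochner_Integration.integral_sum) (rule integrable_pois_exp_dom[OF assms(1)], use assms in auto)

lemma queue_op_le:
  assumes "exp_dom z f" "exp_dom z g" "1 < z" "0 \<le> a" "\<And>x. f x \<le> g x"
  shows "queue_op a f x \<le> queue_op a g x"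
  unfolding queue_op_def by (intro integral_mono integrable_pois_exp_dom[OF assms(1)] integrable_pois_exp_dom[OF assms(2)] assms)

lemma mono_queue_op:
  assumes "exp_dom z f" "1 < z" "0 \<le> a" "mono f"
  shows "mono (queue_op a f)"
  unfolding queue_op_def
  by (intro monoI integral_mono integrable_pois_exp_dom[OF assms(1-3)]) (auto intro!: monoD[OF assms(4)])

lemma antimono_queue_op:
  assumes "exp_dom z f" "1 < z" "0 \<le> a" "antimono f"
  shows "antimono (queue_op a f)"
  unfolding queue_op_def
  by (intro antimonoI integral_mono integrable_pois_exp_dom[OF assms(1-3)]) (auto intro!: antimonoD[OF assms(4)])

lemma queue_op_power:
  assumes "0 \<le> a" "1 < z"
  shows "queue_op a (\<lambda>x. z ^ x) x = z ^ (x - 1) * exp (a * (z - 1))"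
  using assms by (simp add: queue_op_def power_add expectation_pois_power)

lemma exp_dom_queue_op:
  assumes f: "exp_dom z f" "1 < z" "0 \<le> a"
  shows "exp_dom z (queue_op a f)"
proof -
  obtain C where C: "\<And>x. \<bar>f x\<bar> \<le> C * z ^ x" using assms by (auto simp: exp_dom_def)
  have C0: "0 \<le> C" using C[of 0] by simp
  show ?thesis
  proof (rule exp_domI)
    fix x
    have "\<bar>queue_op a f x\<bar> \<le> queue_op a (\<lambda>x. \<bar>f x\<bar>) x"
      unfolding queue_op_def by (rule integral_abs_bound)
    also have "\<dots> \<le> queue_op a (\<lambda>x. C * z ^ x) x"
      using assms C by (intro queue_op_le[of z] exp_dom_cmult exp_dom_power) (auto simp: exp_dom_def)
    also have "\<dots> = C * exp (a * (z - 1)) * z ^ (x - 1)"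
      using assms by (simp add: queue_op_cmult queue_op_power)
    also have "\<dots> \<le> C * exp (a * (z - 1)) * z ^ x"
      using assms C0 by (intro mult_left_mono power_increasing) auto
    finally show "\<bar>queue_op a f x\<bar> \<le> C * exp (a * (z - 1)) * z ^ x" .
  qed
qed

lemma queue_step_nonneg:
  assumes f0: "\<And>x. 0 \<le> f x" and f: "exp_dom z f" "1 < z" "0 \<le> a" "integrable (measure_pmf mu) (\<lambda>x. z ^ x)"
  shows "integrable (measure_pmf (queue_step a mu)) f"
    "measure_pmf.expectation (queue_step a mu) f = measure_pmf.expectation mu (queue_op a f)"
proof -
  have int: "integrable (measure_pmf mu) (queue_op a f)"
    using exp_dom_integrable[OF exp_dom_queue_op] f by blast
  have op0: "0 \<le> queue_op a f x" for x
    unfolding queue_op_def using f0 by (intro integral_nonneg_AE) auto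
  have "(\<integral>\<^sup>+ x. ennreal (f x) \<partial>measure_pmf (queue_step a mu)) = (\<integral>\<^sup>+ x. ennreal (queue_op a f x) \<partial>measure_pmf mu)"
    unfolding queue_step_def queue_op_def
    using integrable_pois_exp_dom[OF f(1-3)] f0 by (simp add: nn_integral_eq_integral)
  also have "\<dots> = ennreal (measure_pmf.expectation mu (queue_op a f))"
    using int op0 by (intro nn_integral_eq_integral) auto
  finally have "has_bochner_integral (measure_pmf (queue_step a mu)) f (measure_pmf.expectation mu (queue_op a f))"
    using f0 op0 by (intro has_bochner_integral_nn_integral integral_nonneg_AE) auto
  then show "integrable (measure_pmf (queue_step a mu)) f"
    "measure_pmf.expectation (queue_step a mu) f = measure_pmf.expectation mu (queue_op a f)"
    by (auto simp: has_bochner_integral_iff)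
qed

lemma integrable_unit_interval:
  fixes f :: "'a \<Rightarrow> real"
  assumes "\<And>x. f x \<in> {0..1}"
  shows "integrable (measure_pmf p) f"
proof (rule measure_pmf.integrable_const_bound[where B = 1])
  show "AE x in measure_pmf p. norm (f x) \<le> 1" using assms by (auto simp: abs_le_iff intro: order_trans[of _ 0])
qed auto

lemma expectation_unit_interval:
  fixes f :: "'a \<Rightarrow> real"
  assumes "\<And>x. f x \<in> {0..1}"
  shows "measure_pmf.expectation p f \<in> {0..1}"
proof -
  have "measure_pmf.expectation p f \<le> measure_pmf.expectation p (\<lambda>_. 1)"
    using assms by (intro integral_mono integrable_unit_interval) auto
  moreover have "0 \<le> measure_pmf.expectation p f"
    using assms by (intro integral_nonneg_AE) auto
  ultimately show ?thesis by (simp add: measure_pmf.prob_space)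
qed

lemma queue_op_range: "(\<And>x. f x \<in> {0..1}) \<Longrightarrow> queue_op a f x \<in> {0..1}"
  unfolding queue_op_def by (rule expectation_unit_interval)

lemma expectation_bind_unit_interval:
  fixes f :: "'b \<Rightarrow> real"
  assumes f: "\<And>x. f x \<in> {0..1}"
  shows "measure_pmf.expectation (bind_pmf p k) f = measure_pmf.expectation p (\<lambda>x. measure_pmf.expectation (k x) f)"
proof -
  have r: "measure_pmf.expectation (k x) f \<in> {0..1}" for x by (rule expectation_unit_interval[OF f])
  have "ennreal (measure_pmf.expectation (bind_pmf p k) f) = (\<integral>\<^sup>+ x. ennreal (f x) \<partial>measure_pmf (bind_pmf p k))"
    using f by (intro nn_integral_eq_integral[symmetric] integrable_unit_interval) auto
  also have "\<dots> = (\<integral>\<^sup>+ x. ennreal (measure_pmf.expectation (k x) f) \<partial>measure_pmf p)"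
    unfolding nn_integral_bind_pmf
    using f by (intro nn_integral_cong nn_integral_eq_integral integrable_unit_interval) auto
  also have "\<dots> = ennreal (measure_pmf.expectation p (\<lambda>x. measure_pmf.expectation (k x) f))"
    using r by (intro nn_integral_eq_integral integrable_unit_interval) auto
  finally show ?thesis
    using expectation_unit_interval[where f = f, OF f]
      expectation_unit_interval[where f = "\<lambda>x. measure_pmf.expectation (k x) f", OF r]
    by (subst (asm) ennreal_inj) auto
qed

lemma expectation_queue_step_unit_interval:
  assumes f: "\<And>x. f x \<in> {0..1}"
  shows "measure_pmf.expectation (queue_step a mu) f = measure_pmf.expectation mu (queue_op a f)"
  unfolding queue_step_def queue_op_def expectation_bind_unit_interval[OF f] by simp

lemma queue_op_diff:
  assumes f: "\<And>x. f x \<in> {0..1}" "antimono f" and "0 \<le> a" "a \<le> b"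
  shows "queue_op b f x \<le> queue_op a f x" "queue_op a f x \<le> queue_op b f x + (b - a)"
proof -
  define g where "g n = f (x - 1 + n)" for n
  define h where "h n = measure_pmf.expectation (pois (b - a)) (\<lambda>m. g (n + m))" for n
  have g: "g n \<in> {0..1}" for n using f by (simp add: g_def)
  have g_mono: "g (n + m) \<le> g n" for n m unfolding g_def by (intro antimonoD[OF f(2)]) auto
  have h: "h n \<in> {0..1}" for n unfolding h_def by (rule expectation_unit_interval[OF g])
  have a: "queue_op a f x = measure_pmf.expectation (pois a) g" by (simp add: queue_op_def g_def[abs_def])
  have "queue_op b f x = measure_pmf.expectation (pois (a + (b - a))) g"
    by (simp add: queue_op_def g_def[abs_def])
  also have "\<dots> = measure_pmf.expectation (pois a) h"
    using assms by (subst pois_add) (simp_all add: expectation_bind_unit_interval[OF g] h_def[abs_def])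
  finally have b: "queue_op b f x = measure_pmf.expectation (pois a) h" .
  have "h n \<le> g n" for n
  proof -
    have "h n \<le> measure_pmf.expectation (pois (b - a)) (\<lambda>m. g n)"
      unfolding h_def using g_mono g by (intro integral_mono integrable_unit_interval) auto
    then show ?thesis by (simp add: measure_pmf.prob_space)
  qed
  then show "queue_op b f x \<le> queue_op a f x"
    unfolding a b using g h by (intro integral_mono integrable_unit_interval) auto
  have "g n \<le> h n + (b - a)" for n
  proof -
    have "g n * pmf (pois (b - a)) 0 = measure_pmf.expectation (pois (b - a)) (\<lambda>m. g (n + m) * of_bool (m = 0))"
      by (subst integral_measure_pmf[of "{0}"]) auto
    also have "\<dots> \<le> h n"
      unfolding h_def using g g[of "n + _"] by (intro integral_mono integrable_unit_interval) (auto simp: of_bool_def)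
    finally have "g n * exp (- (b - a)) \<le> h n" using assms by (simp add: pmf_pois)
    moreover have "1 - exp (- (b - a)) \<le> b - a"
      using exp_ge_add_one_self[of "- (b - a)"] by linarith
    then have "g n * (1 - exp (- (b - a))) \<le> 1 * (b - a)"
      using g[of n] assms by (intro mult_mono) auto
    ultimately show ?thesis by (simp add: algebra_simps)
  qed
  moreover have "integrable (measure_pmf (pois a)) g" "integrable (measure_pmf (pois a)) h"
    by (rule integrable_unit_interval, fact)+
  ultimately show "queue_op a f x \<le> queue_op b f x + (b - a)"
    unfolding a b
    using integral_mono[of "measure_pmf (pois a)" g "\<lambda>n. h n + (b - a)"]
    by (simp add: measure_pmf.prob_space)
qed

text \<open>The sign \<open>s\<close> treats upper and lower limits simultaneously.\<close>

lemma queue_op_compare: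
  assumes f: "\<And>x. f x \<in> {0..1}" "antimono f" and "0 \<le> a" "0 \<le> b" and s: "s = 1 \<or> s = (-1::real)"
    and "s * (a - b) \<le> e" "0 \<le> e"
  shows "s * queue_op b f x \<le> s * queue_op a f x + e"
  using queue_op_diff[OF f, of a b x] queue_op_diff[OF f, of b a x] assms(3-)
  by (cases "a \<le> b") (auto simp: algebra_simps)

section \<open>Convergence of the probability of an empty queue\<close>

definition empty_prob :: "real \<Rightarrow> nat \<Rightarrow> nat \<Rightarrow> real" where
  "empty_prob q n = (queue_op q ^^ n) (\<lambda>x. of_bool (x = 0))"

lemma empty_prob_0: "empty_prob q 0 = (\<lambda>x. of_bool (x = 0))"
  by (simp add: empty_prob_def)

lemma empty_prob_Suc: "empty_prob q (Suc n) = queue_op q (empty_prob q n)"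
  by (simp add: empty_prob_def)

lemma empty_prob_range: "empty_prob q n x \<in> {0..1}"
proof (induction n arbitrary: x)
  case (Suc n)
  show ?case unfolding empty_prob_Suc by (rule queue_op_range[OF Suc.IH])
qed (simp add: empty_prob_0)

lemma exp_dom_empty_prob: "1 < z \<Longrightarrow> exp_dom z (empty_prob q n)"
  using empty_prob_range[of q n] by (intro exp_dom_bounded[where B = 1]) (auto simp: abs_le_iff intro: order_trans[of _ 0])

lemma antimono_empty_prob: "0 \<le> q \<Longrightarrow> antimono (empty_prob q n)"
proof (induction n)
  case (Suc n)
  then show ?case unfolding empty_prob_Suc by (intro antimono_queue_op[OF exp_dom_empty_prob[of 2]]) auto
qed (simp add: empty_prob_0 antimono_def)

lemma decseq_empty_prob_at_0:
  assumes "0 \<le> q" shows "decseq (\<lambda>n. empty_prob q n 0)"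
proof (rule decseq_SucI)
  fix n
  have "queue_op q (empty_prob q n) 0 \<le> queue_op q (\<lambda>_. empty_prob q n 0) 0"
    unfolding queue_op_def
    using empty_prob_range antimonoD[OF antimono_empty_prob[OF assms, of n]]
    by (intro integral_mono integrable_unit_interval) auto
  then show "empty_prob q (Suc n) 0 \<le> empty_prob q n 0"
    by (simp add: empty_prob_Suc queue_op_const)
qed

lemma queue_op_id:
  assumes "0 \<le> a"
  shows "queue_op a real x = real x + (a - 1) + of_bool (x = 0)"
proof -
  have "integrable (measure_pmf (pois a)) (\<lambda>n. real (0 + n))"
    using assms by (intro integrable_pois_exp_dom[OF exp_dom_id[of 2]]) auto
  then have "queue_op a real x = real (x - 1) + a"
    using assms by (simp add: queue_op_def expectation_pois_id measure_pmf.prob_space)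
  then show ?thesis by (cases x) auto
qed

lemma queue_op_power_le:
  assumes "0 \<le> a" "a \<le> r" "1 < z"
  shows "queue_op a (\<lambda>x. z ^ x) x \<le> exp (r * (z - 1)) / z * z ^ x + exp (r * (z - 1))"
proof -
  have "queue_op a (\<lambda>x. z ^ x) x \<le> z ^ (x - 1) * exp (r * (z - 1))"
    using assms by (simp add: queue_op_power mult_right_mono)
  also have "\<dots> \<le> exp (r * (z - 1)) / z * z ^ x + exp (r * (z - 1))"
    using assms by (cases x) auto
  finally show ?thesis .
qed

lemma exists_drift_base:
  fixes r lam :: real
  assumes "0 \<le> r" "r < 1" "0 < lam"
  shows "\<exists>z>1. z \<le> exp lam \<and> exp (r * (z - 1)) < z"
proof -
  define h where "h = min (1 - r) (exp lam - 1)"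
  have h: "0 < h" "h \<le> 1 - r" "h \<le> exp lam - 1" using assms by (auto simp: h_def)
  have rh: "r * h < 1 - r"
  proof -
    have "r * h \<le> r * (1 - r)" using h assms by (intro mult_left_mono) auto
    also have "\<dots> < 1 - r" using assms by simp
    finally show ?thesis .
  qed
  have "exp (r * h) * (1 - r * h) \<le> exp (r * h) * exp (- (r * h))"
    using exp_ge_add_one_self[of "- (r * h)"] by (intro mult_left_mono) auto
  then have 1: "exp (r * h) * (1 - r * h) \<le> 1" by (simp flip: exp_add)
  have "h * (r * h) < h * (1 - r)" using rh h by (intro mult_strict_left_mono)
  then have "1 < (1 + h) * (1 - r * h)" by (simp add: algebra_simps)
  with 1 have "exp (r * h) * (1 - r * h) < (1 + h) * (1 - r * h)" by linarith
  moreover have "0 < 1 - r * h" using rh assms by linarith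
  ultimately have "exp (r * h) < 1 + h" using mult_less_cancel_right_pos by blast
  then show ?thesis using h by (intro exI[of _ "1 + h"]) auto
qed

text \<open>
  The mean at time \<open>n\<close> of the queue started at \<open>x\<close>, summed over the one-step drifts. It is nonnegative,
  nondecreasing in \<open>x\<close> and bounded in \<open>n\<close>, which controls the partial sums of \<^const>\<open>empty_prob\<close>.
\<close>

definition mean_queue :: "real \<Rightarrow> nat \<Rightarrow> nat \<Rightarrow> real" where
  "mean_queue q n x = real x + real n * (q - 1) + (\<Sum>k<n. empty_prob q k x)"

lemma exp_dom_mean_queue: "1 < z \<Longrightarrow> exp_dom z (mean_queue q n)"
  unfolding mean_queue_def
  by (intro exp_dom_add exp_dom_id exp_dom_sum exp_dom_empty_prob exp_dom_bounded[where B = "\<bar>real n * (q - 1)\<bar>"]) auto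

lemma mean_queue_Suc:
  assumes "0 \<le> q"
  shows "mean_queue q (Suc n) = queue_op q (mean_queue q n)"
proof
  fix x
  have d: "exp_dom 2 real" "exp_dom 2 (\<lambda>x. c)" for c
    by (auto intro!: exp_dom_id exp_dom_bounded[where B = "\<bar>c\<bar>"])
  have d': "exp_dom 2 (\<lambda>x. \<Sum>k<n. empty_prob q k x)"
    by (simp add: exp_dom_sum exp_dom_empty_prob)
  have "queue_op q (mean_queue q n) x =
      queue_op q real x + real n * (q - 1) + (\<Sum>k<n. queue_op q (empty_prob q k) x)"
    unfolding mean_queue_def using d d' assms
    by (simp add: queue_op_add[where z = 2] exp_dom_add queue_op_const queue_op_sum[where z = 2] exp_dom_empty_prob)
  also have "(\<Sum>k<n. queue_op q (empty_prob q k) x) + of_bool (x = 0) = (\<Sum>k<Suc n. empty_prob q k x)"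
    by (simp only: sum.lessThan_Suc_shift empty_prob_Suc) (simp add: empty_prob_0)
  then have "queue_op q real x + real n * (q - 1) + (\<Sum>k<n. queue_op q (empty_prob q k) x) = mean_queue q (Suc n) x"
    using assms by (simp add: queue_op_id mean_queue_def algebra_simps)
  finally show "mean_queue q (Suc n) x = queue_op q (mean_queue q n) x" by simp
qed

lemma mono_mean_queue: "0 \<le> q \<Longrightarrow> mono (mean_queue q n)"
proof (induction n)
  case 0
  then show ?case by (simp add: mean_queue_def mono_def)
next
  case (Suc n)
  then show ?case unfolding mean_queue_Suc[OF Suc.prems] by (intro mono_queue_op[OF exp_dom_mean_queue[of 2]]) auto
qed

lemma mean_queue_nonneg: "0 \<le> q \<Longrightarrow> 0 \<le> mean_queue q n x"
proof (induction n arbitrary: x)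
  case 0
  then show ?case by (simp add: mean_queue_def)
next
  case (Suc n)
  then show ?case unfolding mean_queue_Suc[OF Suc.prems] queue_op_def by (intro integral_nonneg_AE) auto
qed

lemma mean_queue_bounded:
  assumes "0 \<le> q" "q < 1"
  shows "\<exists>K. \<forall>n. mean_queue q n 0 \<le> K"
proof -
  obtain z where z: "1 < z" "exp (q * (z - 1)) < z"
    using exists_drift_base[OF assms, of 1] by auto
  define C where "C = exp (q * (z - 1))"
  define g where "g = C / z"
  have C: "0 < C" and g: "0 < g" "g < 1" using z by (auto simp: C_def g_def)
  define D where "D n = C * (1 - g ^ n) / (1 - g)" for n
  have D_Suc: "g ^ n * C + D n = D (Suc n)" for n using g by (simp add: D_def field_simps)
  have *: "(z - 1) * mean_queue q n x \<le> g ^ n * z ^ x + D n" for n x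
  proof (induction n arbitrary: x)
    case 0
    have "1 + real x * (z - 1) \<le> (1 + (z - 1)) ^ x"
      using z by (intro Bernoulli_inequality) auto
    then show ?case by (simp add: mean_queue_def D_def algebra_simps)
  next
    case (Suc n)
    have dom: "exp_dom z (\<lambda>x. z ^ x)" "exp_dom z (\<lambda>x. c)" for c
      using z by (auto intro!: exp_dom_power exp_dom_bounded[where B = "\<bar>c\<bar>"])
    have "(z - 1) * mean_queue q (Suc n) x = queue_op q (\<lambda>x. (z - 1) * mean_queue q n x) x"
      by (simp add: mean_queue_Suc assms queue_op_cmult)
    also have "\<dots> \<le> queue_op q (\<lambda>x. g ^ n * z ^ x + D n) x"
      using z assms Suc.IH by (intro queue_op_le[of z] exp_dom_cmult exp_dom_add dom exp_dom_mean_queue) auto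
    also have "\<dots> = g ^ n * queue_op q (\<lambda>x. z ^ x) x + D n"
      using z assms dom by (simp add: queue_op_add[where z = z] exp_dom_cmult queue_op_cmult queue_op_const)
    also have "\<dots> \<le> g ^ n * (g * z ^ x + C) + D n"
      using g queue_op_power_le[OF assms(1) order_refl z(1), of x]
      by (intro add_right_mono mult_left_mono) (auto simp: g_def C_def)
    also have "\<dots> = g ^ Suc n * z ^ x + D (Suc n)"
      by (simp flip: D_Suc add: algebra_simps)
    finally show ?case .
  qed
  have "mean_queue q n 0 \<le> (1 + C / (1 - g)) / (z - 1)" for n
  proof -
    have "g ^ n \<le> 1" "0 \<le> g ^ n" using g by (auto simp: power_le_one)
    moreover have "D n \<le> C / (1 - g)"
      unfolding D_def using g C by (intro divide_right_mono) auto
    ultimately have "(z - 1) * mean_queue q n 0 \<le> 1 + C / (1 - g)" using *[of n 0] by simp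
    then show ?thesis using z by (simp add: pos_le_divide_eq mult.commute)
  qed
  then show ?thesis by blast
qed

lemma decseq_bounded_sums_tendsto_0:
  fixes a :: "nat \<Rightarrow> real"
  assumes dec: "decseq a" and lo: "\<And>n. 0 \<le> (\<Sum>k<n. a k)" and up: "\<And>n. (\<Sum>k<n. a k) \<le> K"
  shows "a \<longlonglongrightarrow> 0"
proof -
  have nonneg: "0 \<le> a m" for m
  proof (rule ccontr)
    assume m: "\<not> 0 \<le> a m"
    have le: "(\<Sum>k<m + n. a k) \<le> (\<Sum>k<m. a k) + real n * a m" for n
    proof (induction n)
      case (Suc n)
      have "a (m + n) \<le> a m" by (rule decseqD[OF dec]) simp
      with Suc show ?case by (simp add: algebra_simps)
    qed simp
    obtain n where "K < real n * (- a m)"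
      using reals_Archimedean3[of "- a m"] m by auto
    then show False using le[of n] lo[of "m + n"] up[of m] by simp
  qed
  have "summable a" using nonneg up by (rule summableI_nonneg_bounded)
  then show ?thesis by (rule summable_LIMSEQ_zero)
qed

lemma empty_prob_tendsto:
  assumes q: "0 \<le> q" "q < 1"
  shows "(\<lambda>n. empty_prob q n x) \<longlonglongrightarrow> 1 - q"
proof -
  obtain K where K: "\<And>n. mean_queue q n 0 \<le> K" using mean_queue_bounded[OF q] by blast
  have sum0: "(\<Sum>k<n. empty_prob q k 0 - (1 - q)) = mean_queue q n 0" for n
    by (simp add: mean_queue_def sum_subtractf sum.distrib algebra_simps)
  have "(\<lambda>n. empty_prob q n 0 - (1 - q)) \<longlonglongrightarrow> 0"
  proof (rule decseq_bounded_sums_tendsto_0)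
    show "decseq (\<lambda>n. empty_prob q n 0 - (1 - q))"
      using decseq_empty_prob_at_0[OF q(1)] by (simp add: decseq_def)
  qed (use K mean_queue_nonneg[OF q(1)] in \<open>simp_all add: sum0\<close>)
  then have 0: "(\<lambda>n. empty_prob q n 0) \<longlonglongrightarrow> 1 - q" by (simp add: LIM_zero_iff)
  have "summable (\<lambda>n. empty_prob q n 0 - empty_prob q n x)"
  proof (rule summableI_nonneg_bounded)
    show "0 \<le> empty_prob q n 0 - empty_prob q n x" for n
      using antimonoD[OF antimono_empty_prob[OF q(1), of n], of 0 x] by simp
    show "(\<Sum>k<n. empty_prob q k 0 - empty_prob q k x) \<le> real x" for n
      using monoD[OF mono_mean_queue[OF q(1), of n], of 0 x] by (simp add: mean_queue_def sum_subtractf)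
  qed
  from tendsto_diff[OF 0 summable_LIMSEQ_zero[OF this]] show ?thesis by simp
qed

lemma expectation_empty_prob_uniform:
  assumes q: "0 \<le> q" "q < 1" and e: "0 < e"
  shows "\<forall>\<^sub>F n in sequentially. \<forall>mu. integrable (measure_pmf mu) real \<longrightarrow> measure_pmf.expectation mu real \<le> r \<longrightarrow>
     \<bar>measure_pmf.expectation mu (empty_prob q n) - (1 - q)\<bar> < e"
proof -
  obtain K :: nat where K: "3 * \<bar>r\<bar> / e < real K" using reals_Archimedean2 by blast
  then have Kpos: "0 < real K" using e by (smt (verit) divide_nonneg_pos)
  have "\<forall>\<^sub>F n in sequentially. \<bar>empty_prob q n x - (1 - q)\<bar> < e / 3" for x
    using tendstoD[OF empty_prob_tendsto[OF q], of "e / 3" x] e by (simp add: dist_real_def)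
  from this[of 0] this[of K] show ?thesis
  proof eventually_elim
    case (elim n)
    show ?case
    proof (intro allI impI)
      fix mu assume mu: "integrable (measure_pmf mu) real" "measure_pmf.expectation mu real \<le> r"
      have int: "integrable (measure_pmf mu) (empty_prob q n)"
        by (rule integrable_unit_interval[OF empty_prob_range])
      have anti: "x \<le> y \<Longrightarrow> empty_prob q n y \<le> empty_prob q n x" for x y
        by (rule antimonoD[OF antimono_empty_prob[OF q(1)]])
      have "measure_pmf.expectation mu (empty_prob q n) \<le> measure_pmf.expectation mu (\<lambda>_. empty_prob q n 0)"
        using anti[of 0] int by (intro integral_mono) auto
      then have 1: "measure_pmf.expectation mu (empty_prob q n) \<le> empty_prob q n 0"
        by (simp add: measure_pmf.prob_space)
      have "empty_prob q n K - real x / real K \<le> empty_prob q n x" for x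
      proof (cases "x \<le> K")
        case True
        then show ?thesis using anti[OF True] by (smt (verit) Kpos divide_nonneg_pos of_nat_0_le_iff)
      next
        case False
        then have "1 \<le> real x / real K" using Kpos by simp
        then show ?thesis using empty_prob_range[of q n K] empty_prob_range[of q n x] by auto
      qed
      then have "measure_pmf.expectation mu (\<lambda>x. empty_prob q n K - real x / real K) \<le> measure_pmf.expectation mu (empty_prob q n)"
        using mu int by (intro integral_mono) auto
      then have 2: "empty_prob q n K - measure_pmf.expectation mu real / real K \<le> measure_pmf.expectation mu (empty_prob q n)"
        using mu by (simp add: measure_pmf.prob_space)
      have "measure_pmf.expectation mu real / real K \<le> \<bar>r\<bar> / real K"
        using mu Kpos by (intro divide_right_mono) auto
      also have "\<dots> < e / 3" using K Kpos e by (simp add: field_simps)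
      finally show "\<bar>measure_pmf.expectation mu (empty_prob q n) - (1 - q)\<bar> < e"
        using 1 2 elim by linarith
    qed
  qed
qed

section \<open>Invariant laws\<close>

lemma pmf_queue_step:
  "pmf (queue_step a p) k =
    pmf p 0 * pmf (pois a) k + (\<Sum>j\<le>k. pmf p (Suc j) * pmf (pois a) (k - j))"
proof -
  have "pmf (queue_step a p) k = (\<Sum>x\<le>Suc k. pmf p x * pmf (pois a) (k - (x - 1)))"
    unfolding queue_step_def pmf_bind pmf_map_plus
    by (subst integral_measure_pmf[of "{..Suc k}"]) (auto split: if_splits intro!: sum.cong)
  then show ?thesis by (simp only: sum.atMost_Suc_shift) simp
qed

lemma pmf_Suc_queue_step:
  assumes "0 \<le> a"
  shows "pmf p (Suc k) = exp a * (pmf (queue_step a p) k - pmf p 0 * pmf (pois a) k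
    - (\<Sum>j<k. pmf p (Suc j) * pmf (pois a) (k - j)))"
  using assms
  by (simp add: pmf_queue_step pmf_pois[of a 0] lessThan_Suc_atMost[symmetric] exp_minus_inverse flip: exp_add)

lemma pmf_0_invariant:
  assumes q: "0 \<le> q" "q < 1" and inv: "queue_step q p = p"
  shows "pmf p 0 = 1 - q"
proof -
  have "measure_pmf.expectation p (empty_prob q n) = pmf p 0" for n
  proof (induction n)
    case 0
    show ?case unfolding empty_prob_0 by (subst integral_measure_pmf[of "{0}"]) auto
  next
    case (Suc n)
    then show ?case
      using expectation_queue_step_unit_interval[where f = "empty_prob q n" and a = q and mu = p, OF empty_prob_range]
      by (simp add: inv empty_prob_Suc)
  qed
  moreover have "(\<lambda>n. measure_pmf.expectation p (empty_prob q n)) \<longlonglongrightarrow> measure_pmf.expectation p (\<lambda>_. 1 - q)"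
  proof (rule integral_dominated_convergence[where w = "\<lambda>_. 1"])
    show "AE x in measure_pmf p. norm (empty_prob q n x) \<le> 1" for n
      using empty_prob_range[of q n] by simp
  qed (auto simp: empty_prob_tendsto[OF q])
  ultimately show ?thesis by (simp add: measure_pmf.prob_space LIMSEQ_const_iff)
qed

lemma invariant_unique:
  assumes q: "0 \<le> q" "q < 1" and inv: "queue_step q p = p" "queue_step q p' = p'"
  shows "p = p'"
proof (rule pmf_eqI)
  show "pmf p k = pmf p' k" for k
  proof (induction k rule: less_induct)
    case (less k)
    show ?case
    proof (cases k)
      case 0
      then show ?thesis using pmf_0_invariant[OF q] inv by simp
    next
      case (Suc m)
      then show ?thesis
        using less pmf_Suc_queue_step[OF q(1), of p m] pmf_Suc_queue_step[OF q(1), of p' m] inv by simp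
    qed
  qed
qed

lemma MD1_inv_eq: "0 \<le> q \<Longrightarrow> q < 1 \<Longrightarrow> queue_step q p = p \<Longrightarrow> MD1_inv q = p"
  unfolding MD1_inv_def by (rule the_equality) (auto intro: invariant_unique)

lemma pmf_pois_tendsto:
  assumes "X \<longlonglongrightarrow> a" "\<And>t. 0 \<le> X t"
  shows "(\<lambda>t. pmf (pois (X t)) k) \<longlonglongrightarrow> pmf (pois a) k"
proof -
  have "0 \<le> a" using assms by (intro LIMSEQ_le_const) auto
  then show ?thesis using assms(2) by (simp add: pmf_pois) (intro tendsto_intros assms(1), simp)
qed

lemma weak_conv_m_pmf_nat:
  assumes "\<And>k. (\<lambda>t. pmf (p t) k) \<longlonglongrightarrow> pmf q k"
  shows "weak_conv_m (\<lambda>t. distr (measure_pmf (p t)) borel real) (distr (measure_pmf q) borel real)"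
proof -
  have cdf: "cdf (distr (measure_pmf p) borel real) y = (\<Sum>k | real k \<le> y. pmf p k)" for p y
  proof -
    have "finite {k. real k \<le> y}"
      by (rule finite_subset[of _ "{..nat \<lfloor>y\<rfloor>}"]) (auto simp: le_nat_floor)
    then show ?thesis
      by (simp add: cdf_def measure_distr vimage_def measure_measure_pmf_finite)
  qed
  show ?thesis
    unfolding weak_conv_m_def weak_conv_def cdf using assms by (auto intro!: tendsto_sum)
qed

section \<open>The nonlinear process\<close>

declare nl_law.simps(2) [simp del]

locale subcritical_nl_queue =
  fixes mu0 :: "nat pmf" and r z :: real
  assumes r: "0 \<le> r" "r < 1"
    and z: "1 < z" "exp (r * (z - 1)) < z"
    and integrable_mu0: "integrable (measure_pmf mu0) (\<lambda>x. z ^ x)"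
    and mean_mu0: "measure_pmf.expectation mu0 real = r"
begin

abbreviation mu :: "nat \<Rightarrow> nat pmf" where "mu \<equiv> nl_law mu0"

definition rho :: "nat \<Rightarrow> real" where "rho t = measure_pmf.prob (mu t) {x. 0 < x}"

lemma mu_Suc: "mu (Suc t) = queue_step (rho t) (mu t)"
  by (simp add: rho_def nl_law.simps)

lemma rho_nonneg: "0 \<le> rho t"
  by (simp add: rho_def)

lemma integrable_power: "integrable (measure_pmf (mu t)) (\<lambda>x. z ^ x)"
proof (induction t)
  case 0
  then show ?case by (simp add: integrable_mu0)
next
  case (Suc t)
  then show ?case unfolding mu_Suc
    using z by (intro queue_step_nonneg[of _ z] exp_dom_power rho_nonneg) auto
qed

lemma integrable_exp_dom: "exp_dom z f \<Longrightarrow> integrable (measure_pmf (mu t)) f"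
  using exp_dom_integrable integrable_power z by blast

lemma integrable_real [simp]: "integrable (measure_pmf (mu t)) real"
  using z by (intro integrable_exp_dom exp_dom_id)

lemma integrable_square [simp]: "integrable (measure_pmf (mu t)) (\<lambda>x. (real x)\<^sup>2)"
  using z by (intro integrable_exp_dom exp_dom_square)

lemma expectation_mu_Suc:
  "(\<And>x. 0 \<le> f x) \<Longrightarrow> exp_dom z f \<Longrightarrow>
    measure_pmf.expectation (mu (Suc t)) f = measure_pmf.expectation (mu t) (queue_op (rho t) f)"
  unfolding mu_Suc using z by (intro queue_step_nonneg(2)[of _ z] rho_nonneg integrable_power)

lemma integrable_of_bool [simp]: "integrable (measure_pmf (mu t)) (\<lambda>x. of_bool (P x) :: real)"
  by (rule integrable_unit_interval) auto

lemma expectation_of_bool_0: "measure_pmf.expectation (mu t) (\<lambda>x. of_bool (x = 0)) = 1 - rho t"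
proof -
  have "measure_pmf.expectation (mu t) (\<lambda>x. of_bool (x = 0)) = pmf (mu t) 0"
    by (subst integral_measure_pmf[of "{0}"]) auto
  also have "{0} = space (measure_pmf (mu t)) - {x. 0 < x}" by auto
  then have "pmf (mu t) 0 = 1 - rho t"
    unfolding rho_def measure_pmf_single[symmetric] by (simp only: measure_pmf.prob_compl sets_measure_pmf UNIV_I)
  finally show ?thesis .
qed

lemma mean: "measure_pmf.expectation (mu t) real = r"
proof (induction t)
  case 0
  then show ?case by (simp add: mean_mu0)
next
  case (Suc t)
  have "measure_pmf.expectation (mu (Suc t)) real =
      measure_pmf.expectation (mu t) (\<lambda>x. real x + (rho t - 1) + of_bool (x = 0))"
    using z by (subst expectation_mu_Suc) (auto simp: queue_op_id[OF rho_nonneg, abs_def] exp_dom_id)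
  also have "\<dots> = r"
    using Suc expectation_of_bool_0 by (simp add: measure_pmf.prob_space)
  finally show ?case .
qed

lemma rho_le: "rho t \<le> r"
proof -
  have "measure_pmf.expectation (mu t) (\<lambda>x. 1 - of_bool (x = 0)) \<le> measure_pmf.expectation (mu t) real"
    by (intro integral_mono) auto
  then show ?thesis using expectation_of_bool_0 mean by (simp add: measure_pmf.prob_space)
qed

definition second_moment :: "nat \<Rightarrow> real" where
  "second_moment t = measure_pmf.expectation (mu t) (\<lambda>x. (real x)\<^sup>2)"

lemma queue_op_square:
  assumes "0 \<le> a"
  shows "queue_op a (\<lambda>x. (real x)\<^sup>2) x =
    (real x)\<^sup>2 + (2 * a - 2) * real x + (2 * a - 1) * of_bool (x = 0) + (1 - a + a\<^sup>2)"
proof -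
  have "integrable (measure_pmf (pois a)) (\<lambda>n. real (0 + n))"
    "integrable (measure_pmf (pois a)) (\<lambda>n. (real (0 + n))\<^sup>2)"
    using assms integrable_pois_exp_dom[OF exp_dom_id[of 2], of a 0]
      integrable_pois_exp_dom[OF exp_dom_square[of 2], of a 0] by auto
  then have "queue_op a (\<lambda>x. (real x)\<^sup>2) x = (real (x - 1))\<^sup>2 + 2 * real (x - 1) * a + (a\<^sup>2 + a)"
    using assms by (simp add: queue_op_def expectation_pois_id expectation_pois_square measure_pmf.prob_space power2_sum)
  then show ?thesis by (cases x) (auto simp: power2_eq_square algebra_simps)
qed

lemma second_moment_Suc:
  "second_moment (Suc t) = second_moment t - ((rho t)\<^sup>2 - 2 * (1 + r) * rho t + 2 * r)"
proof -
  have "second_moment (Suc t) = measure_pmf.expectation (mu t)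
      (\<lambda>x. (real x)\<^sup>2 + (2 * rho t - 2) * real x + (2 * rho t - 1) * of_bool (x = 0) + (1 - rho t + (rho t)\<^sup>2))"
    unfolding second_moment_def
    using z by (subst expectation_mu_Suc) (auto simp: queue_op_square[OF rho_nonneg, abs_def] exp_dom_square)
  also have "\<dots> = second_moment t + (2 * rho t - 2) * r + (2 * rho t - 1) * (1 - rho t) + (1 - rho t + (rho t)\<^sup>2)"
    using mean expectation_of_bool_0 by (simp add: measure_pmf.prob_space second_moment_def)
  finally show ?thesis by (simp add: algebra_simps power2_eq_square)
qed

lemma second_moment_bounded: "\<exists>K. \<forall>t. 0 \<le> second_moment t \<and> second_moment t \<le> K"
proof -
  define C where "C = exp (r * (z - 1))"
  define W where "W t = measure_pmf.expectation (mu t) (\<lambda>x. z ^ x)" for t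
  have C: "0 < C" "C / z < 1" "0 < C / z" using z by (auto simp: C_def)
  have W_Suc: "W (Suc t) \<le> C / z * W t + C" for t
  proof -
    have "W (Suc t) = measure_pmf.expectation (mu t) (queue_op (rho t) (\<lambda>x. z ^ x))"
      unfolding W_def using z by (intro expectation_mu_Suc exp_dom_power) auto
    also have "\<dots> \<le> measure_pmf.expectation (mu t) (\<lambda>x. C / z * z ^ x + C)"
    proof (rule integral_mono)
      show "integrable (measure_pmf (mu t)) (queue_op (rho t) (\<lambda>x. z ^ x))"
        using z by (intro integrable_exp_dom exp_dom_queue_op exp_dom_power rho_nonneg)
      show "integrable (measure_pmf (mu t)) (\<lambda>x. C / z * z ^ x + C)"
        by (intro Bochner_Integration.integrable_add integrable_mult_right integrable_power) simp
      show "queue_op (rho t) (\<lambda>x. z ^ x) x \<le> C / z * z ^ x + C" for x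
        unfolding C_def using z by (intro queue_op_power_le rho_nonneg rho_le)
    qed
    also have "\<dots> = C / z * W t + C"
      using integrable_power by (simp add: W_def measure_pmf.prob_space)
    finally show ?thesis .
  qed
  define B where "B = max (W 0) (C / (1 - C / z))"
  have W: "W t \<le> B" for t
  proof (induction t)
    case (Suc t)
    have "C \<le> (1 - C / z) * B"
      using C pos_divide_le_eq[of "1 - C / z" C B] by (simp add: B_def mult.commute)
    moreover have "C / z * W t \<le> C / z * B" using C Suc by (intro mult_left_mono) auto
    ultimately show ?case using W_Suc[of t] by (simp add: algebra_simps)
  qed (simp add: B_def)
  obtain D where D: "\<And>x. \<bar>(real x)\<^sup>2\<bar> \<le> D * z ^ x"
    using exp_dom_square[OF z(1)] by (auto simp: exp_dom_def)
  have "0 \<le> D" using D[of 0] by simp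
  have "second_moment t \<le> D * B" for t
  proof -
    have "second_moment t \<le> measure_pmf.expectation (mu t) (\<lambda>x. D * z ^ x)"
      unfolding second_moment_def using D integrable_power by (intro integral_mono) auto
    also have "\<dots> \<le> D * B" using W[of t] \<open>0 \<le> D\<close> by (simp add: W_def mult_left_mono)
    finally show ?thesis .
  qed
  moreover have "0 \<le> second_moment t" for t by (simp add: second_moment_def)
  ultimately show ?thesis by blast
qed

lemma expectation_empty_prob_back:
  assumes s: "s = 1 \<or> s = (-1::real)" and q: "0 \<le> q" and e: "0 \<le> e"
    and close: "\<And>i. i < n \<Longrightarrow> s * (rho (t + i) - q) \<le> e"
  shows "s * measure_pmf.expectation (mu t) (empty_prob q (n + j))
    \<le> s * measure_pmf.expectation (mu (t + n)) (empty_prob q j) + real n * e"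
  using close
proof (induction n arbitrary: j)
  case (Suc n)
  let ?p = "mu (t + n)"
  have int: "integrable (measure_pmf ?p) (empty_prob q (Suc j))"
      "integrable (measure_pmf ?p) (queue_op (rho (t + n)) (empty_prob q j))"
    by (intro integrable_unit_interval empty_prob_range queue_op_range)+
  have "measure_pmf.expectation ?p (\<lambda>x. s * empty_prob q (Suc j) x)
      \<le> measure_pmf.expectation ?p (\<lambda>x. s * queue_op (rho (t + n)) (empty_prob q j) x + e)"
    unfolding empty_prob_Suc
    using int Suc.prems[of n]
    by (intro integral_mono queue_op_compare empty_prob_range antimono_empty_prob rho_nonneg q s e)
      (auto simp: empty_prob_Suc)
  also have "\<dots> = s * measure_pmf.expectation (mu (t + Suc n)) (empty_prob q j) + e"
    using int expectation_queue_step_unit_interval[where f = "empty_prob q j", OF empty_prob_range]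
    by (simp add: measure_pmf.prob_space mu_Suc)
  finally have "s * measure_pmf.expectation ?p (empty_prob q (Suc j))
      \<le> s * measure_pmf.expectation (mu (t + Suc n)) (empty_prob q j) + e"
    by simp
  moreover have "s * measure_pmf.expectation (mu t) (empty_prob q (n + Suc j))
      \<le> s * measure_pmf.expectation ?p (empty_prob q (Suc j)) + real n * e"
    using Suc.IH[of "Suc j"] Suc.prems by simp
  ultimately show ?case by (simp add: algebra_simps)
qed simp

lemma expectation_queue_op_empty:
  assumes "0 \<le> a"
  shows "measure_pmf.expectation (mu t) (queue_op a (empty_prob q 0)) =
    measure_pmf.expectation (mu t) (\<lambda>x. of_bool (x \<le> 1)) * exp (- a)"
proof -
  have "queue_op a (empty_prob q 0) x = of_bool (x \<le> 1) * exp (- a)" for x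
  proof -
    have "queue_op a (empty_prob q 0) x = (if x \<le> 1 then pmf (pois a) 0 else 0)"
      unfolding queue_op_def empty_prob_0
      by (subst integral_measure_pmf[of "{0}"]) auto
    then show ?thesis using assms by (simp add: pmf_pois)
  qed
  then have "queue_op a (empty_prob q 0) = (\<lambda>x. of_bool (x \<le> 1) * exp (- a))" by blast
  then show ?thesis by simp
qed

lemma extremal_rho_back:
  assumes s: "s = 1 \<or> s = (-1::real)" and q: "0 \<le> q" "q < 1" and d: "0 < d"
    and ev: "\<And>e. 0 < e \<Longrightarrow> \<forall>\<^sub>F t in sequentially. s * (rho t - q) \<le> e"
  shows "\<exists>d'>0. \<forall>\<^sub>F t in sequentially. - d' \<le> s * (rho (Suc t) - q) \<longrightarrow> - d \<le> s * (rho t - q)"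
proof -
  define k where "k = (1 - r) * exp (- 1) * d / 4"
  have k: "0 < k" using r d by (simp add: k_def)
  obtain n where n: "\<And>t. \<bar>measure_pmf.expectation (mu t) (empty_prob q (n + 1)) - (1 - q)\<bar> < k"
    using expectation_empty_prob_uniform[OF q k, of r] mean
    unfolding eventually_sequentially by (metis order_refl integrable_real trans_le_add1)
  define e where "e = k / (real n + 1)"
  have e: "0 < e" "real n * e \<le> k" using k by (auto simp: e_def field_simps)
  obtain N where N: "\<And>t. N \<le> t \<Longrightarrow> s * (rho t - q) \<le> e"
    using ev[OF e(1)] by (auto simp: eventually_sequentially)
  have "- d \<le> s * (rho t - q)" if t: "N + n \<le> t" and near: "- k \<le> s * (rho (Suc t) - q)" for t
  proof (rule ccontr)
    assume far: "\<not> - d \<le> s * (rho t - q)"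
    define p where "p = measure_pmf.expectation (mu t) (\<lambda>x. of_bool (x \<le> 1) :: real)"
    have "1 - rho t \<le> p"
      unfolding p_def expectation_of_bool_0[symmetric] by (intro integral_mono) auto
    then have p: "1 - r \<le> p" using rho_le[of t] by simp
    have "s * measure_pmf.expectation (mu (t - n)) (empty_prob q (n + 1))
        \<le> s * measure_pmf.expectation (mu (t - n + n)) (empty_prob q 1) + real n * e"
      using t e by (intro expectation_empty_prob_back s q N) auto
    also have "measure_pmf.expectation (mu (t - n + n)) (empty_prob q 1) = p * exp (- q)"
      using t q by (simp add: empty_prob_Suc p_def expectation_queue_op_empty)
    finally have 1: "s * (1 - q) - 2 * k \<le> s * (p * exp (- q))"
      using n[of "t - n"] e s by auto
    have "1 - rho (Suc t) = measure_pmf.expectation (mu (Suc t)) (empty_prob q 0)"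
      using expectation_of_bool_0[of "Suc t"] by (simp add: empty_prob_0)
    also have "\<dots> = p * exp (- rho t)"
      unfolding mu_Suc expectation_queue_step_unit_interval[OF empty_prob_range]
      by (simp add: p_def expectation_queue_op_empty rho_nonneg)
    finally have "1 - rho (Suc t) = p * exp (- rho t)" .
    then have "s * (p * exp (- rho t)) \<le> s * (1 - q) + k"
      unfolding \<open>1 - rho (Suc t) = p * exp (- rho t)\<close>[symmetric] using near by (simp add: algebra_simps)
    with 1 have 2: "p * (s * (exp (- rho t) - exp (- q))) \<le> 3 * k"
      by (simp add: algebra_simps)
    have exp_diff_ge: "exp (- 1) * d \<le> exp (- a) - exp (- b)" if "a + d \<le> b" "b \<le> 1" for a b :: real
    proof -
      have "exp (- 1) * d \<le> exp (- b) * (b - a)" using that d by (intro mult_mono) auto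
      also have "\<dots> \<le> exp (- b) * (exp (b - a) - 1)"
        by (intro mult_left_mono) (use exp_ge_add_one_self[of "b - a"] in linarith, simp)
      also have "\<dots> = exp (- a) - exp (- b)" by (simp add: right_diff_distrib flip: exp_add)
      finally show ?thesis .
    qed
    have "exp (- 1) * d \<le> s * (exp (- rho t) - exp (- q))"
      using s far q r rho_le[of t] exp_diff_ge[of "rho t" q] exp_diff_ge[of q "rho t"] by auto
    then have "(1 - r) * (exp (- 1) * d) \<le> p * (s * (exp (- rho t) - exp (- q)))"
      using p r d by - (rule mult_mono, auto)
    with 2 k show False by (simp add: k_def)
  qed
  then show ?thesis using k by (intro exI[of _ k]) (auto simp: eventually_sequentially)
qed

lemma extremal_rho_back_n:
  assumes s: "s = 1 \<or> s = (-1::real)" and q: "0 \<le> q" "q < 1"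
    and ev: "\<And>e. 0 < e \<Longrightarrow> \<forall>\<^sub>F t in sequentially. s * (rho t - q) \<le> e"
  shows "0 < d \<Longrightarrow> \<exists>d'>0. \<forall>\<^sub>F t in sequentially.
    - d' \<le> s * (rho (t + n) - q) \<longrightarrow> (\<forall>i\<le>n. - d \<le> s * (rho (t + i) - q))"
proof (induction n)
  case 0
  then show ?case by (intro exI[of _ d]) auto
next
  case (Suc n)
  from Suc obtain d1 where d1: "0 < d1" and ev1: "\<forall>\<^sub>F t in sequentially.
    - d1 \<le> s * (rho (t + n) - q) \<longrightarrow> (\<forall>i\<le>n. - d \<le> s * (rho (t + i) - q))" by blast
  from extremal_rho_back[OF s q d1 ev] obtain d2 where d2: "0 < d2"
    and ev2: "\<forall>\<^sub>F t in sequentially. - d2 \<le> s * (rho (Suc t) - q) \<longrightarrow> - d1 \<le> s * (rho t - q)" by blast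
  from ev2 have "\<forall>\<^sub>F t in sequentially. - d2 \<le> s * (rho (Suc (t + n)) - q) \<longrightarrow> - d1 \<le> s * (rho (t + n) - q)"
    by (rule sequentially_offset)
  with ev1 have "\<forall>\<^sub>F t in sequentially.
    - min d d2 \<le> s * (rho (t + Suc n) - q) \<longrightarrow> (\<forall>i\<le>Suc n. - d \<le> s * (rho (t + i) - q))"
    by eventually_elim (auto simp: le_Suc_eq min_def split: if_splits)
  then show ?case using d2 Suc.prems by (intro exI[of _ "min d d2"]) auto
qed

lemma extremal_rho_eq:
  assumes s: "s = 1 \<or> s = (-1::real)" and q: "0 \<le> q" "q < 1"
    and ev: "\<And>e. 0 < e \<Longrightarrow> \<forall>\<^sub>F t in sequentially. s * (rho t - q) \<le> e"
    and fr: "\<And>e. 0 < e \<Longrightarrow> \<exists>\<^sub>F t in sequentially. - e \<le> s * (rho t - q)"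
  shows "q = rho_of r"
proof -
  define h where "h y = y\<^sup>2 - 2 * (1 + r) * y + 2 * r" for y :: real
  have h_lip: "\<bar>h y - h q\<bar> \<le> 4 * \<bar>y - q\<bar>" if "0 \<le> y" "y \<le> r" for y
  proof -
    have "h y - h q = (y + q - 2 * (1 + r)) * (y - q)"
      by (simp add: h_def power2_eq_square algebra_simps)
    moreover have "\<bar>y + q - 2 * (1 + r)\<bar> \<le> 4" using that r q by auto
    ultimately show ?thesis by (simp add: abs_mult mult_right_mono)
  qed
  obtain K where K: "\<And>t. 0 \<le> second_moment t" "\<And>t. second_moment t \<le> K"
    using second_moment_bounded by blast
  have sm: "second_moment (t + n) = second_moment t - (\<Sum>i<n. h (rho (t + i)))" for t n
    by (induction n) (auto simp: second_moment_Suc h_def)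
  have "h q = 0"
  proof (rule ccontr)
    assume hq: "h q \<noteq> 0"
    define d where "d = \<bar>h q\<bar> / 8"
    have d: "0 < d" using hq by (simp add: d_def)
    obtain n where n: "K < real n * (\<bar>h q\<bar> / 2)"
      using reals_Archimedean3[of "\<bar>h q\<bar> / 2"] hq by auto
    obtain d' where d': "0 < d'" and ev': "\<forall>\<^sub>F t in sequentially.
      - d' \<le> s * (rho (t + n) - q) \<longrightarrow> (\<forall>i\<le>n. - d \<le> s * (rho (t + i) - q))"
      using extremal_rho_back_n[OF s q ev d, of n] by blast
    from ev' ev[OF d] obtain N where
      N: "\<And>t. N \<le> t \<Longrightarrow> - d' \<le> s * (rho (t + n) - q) \<Longrightarrow> (\<forall>i\<le>n. - d \<le> s * (rho (t + i) - q))"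
         "\<And>t. N \<le> t \<Longrightarrow> s * (rho t - q) \<le> d"
      unfolding eventually_sequentially by (metis le_trans linorder_linear)
    obtain t' where t': "N + n \<le> t'" "- d' \<le> s * (rho t' - q)"
      using fr[OF d'] unfolding frequently_sequentially by blast
    define t where "t = t' - n"
    have t: "N \<le> t" "t' = t + n" using t' by (auto simp: t_def)
    have close: "\<bar>rho (t + i) - q\<bar> \<le> d" if "i < n" for i
    proof -
      have "- d \<le> s * (rho (t + i) - q)" using N(1)[of t] t t' that by simp
      moreover have "s * (rho (t + i) - q) \<le> d" using N(2)[of "t + i"] t by simp
      ultimately show ?thesis using s by (auto simp: abs_le_iff)
    qed
    have "\<bar>(\<Sum>i<n. h (rho (t + i)) - h q)\<bar> \<le> (\<Sum>i<n. \<bar>h q\<bar> / 2)"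
    proof (rule order_trans[OF sum_abs sum_mono])
      fix i assume "i \<in> {..<n}"
      then have "4 * \<bar>rho (t + i) - q\<bar> \<le> \<bar>h q\<bar> / 2" using close[of i] by (simp add: d_def)
      then show "\<bar>h (rho (t + i)) - h q\<bar> \<le> \<bar>h q\<bar> / 2"
        using h_lip[OF rho_nonneg rho_le, of "t + i"] by (rule order_trans[rotated])
    qed
    then have "\<bar>(\<Sum>i<n. h (rho (t + i))) - real n * h q\<bar> \<le> real n * (\<bar>h q\<bar> / 2)"
      by (simp add: sum_subtractf)
    moreover have "\<bar>real n * h q\<bar> = 2 * (real n * (\<bar>h q\<bar> / 2))" by (simp add: abs_mult)
    ultimately show False using sm[of t n] K[of t] K[of "t + n"] n by linarith
  qed
  then have "(1 + r - q)\<^sup>2 = 1 + r\<^sup>2" by (simp add: h_def power2_eq_square algebra_simps)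
  then have "sqrt (1 + r\<^sup>2) = 1 + r - q"
    using q r by (intro real_sqrt_unique) auto
  then show ?thesis by (simp add: rho_of_def)
qed

lemma rho_tendsto: "rho \<longlonglongrightarrow> rho_of r" and rho_of_range: "0 \<le> rho_of r" "rho_of r \<le> r"
proof -
  let ?X = "\<lambda>t. ereal (rho t)"
  have *: "0 \<le> Liminf sequentially ?X" "Liminf sequentially ?X \<le> Limsup sequentially ?X" "Limsup sequentially ?X \<le> ereal r"
    by (auto intro!: Liminf_bounded Limsup_bounded Liminf_le_Limsup simp: rho_nonneg rho_le)
  then obtain q where q: "Limsup sequentially ?X = ereal q"
    by (cases "Limsup sequentially ?X") auto
  from * obtain p where p: "Liminf sequentially ?X = ereal p"
    by (cases "Liminf sequentially ?X") auto
  from * have pq: "0 \<le> p" "p \<le> q" "q \<le> r" by (auto simp: p q)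
  have "q = rho_of r"
  proof (rule extremal_rho_eq[of 1])
    fix e :: real assume e: "0 < e"
    show "\<forall>\<^sub>F t in sequentially. 1 * (rho t - q) \<le> e"
      using Limsup_lessD[of sequentially ?X "ereal (q + e)"] q e by (auto elim: eventually_mono)
    show "\<exists>\<^sub>F t in sequentially. - e \<le> 1 * (rho t - q)"
    proof (rule ccontr)
      assume "\<not> ?thesis"
      then have "\<forall>\<^sub>F t in sequentially. ?X t \<le> ereal (q - e)"
        unfolding not_frequently by (auto elim: eventually_mono)
      from Limsup_bounded[OF this] show False using q e by simp
    qed
  qed (use pq r in auto)
  moreover have "p = rho_of r"
  proof (rule extremal_rho_eq[of "-1"])
    fix e :: real assume e: "0 < e"
    show "\<forall>\<^sub>F t in sequentially. - 1 * (rho t - p) \<le> e"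
      using less_LiminfD[of "ereal (p - e)" sequentially ?X] p e by (auto elim: eventually_mono)
    show "\<exists>\<^sub>F t in sequentially. - e \<le> - 1 * (rho t - p)"
    proof (rule ccontr)
      assume "\<not> ?thesis"
      then have "\<forall>\<^sub>F t in sequentially. ereal (p + e) \<le> ?X t"
        unfolding not_frequently by (auto elim: eventually_mono)
      from Liminf_bounded[OF this] show False using p e by simp
    qed
  qed (use pq r in auto)
  ultimately show "rho \<longlonglongrightarrow> rho_of r"
    using Liminf_eq_Limsup[of sequentially ?X "ereal (rho_of r)"] p q by simp
  show "0 \<le> rho_of r" "rho_of r \<le> r" using pq \<open>q = rho_of r\<close> by auto
qed

lemma pmf_mu_convergent: "convergent (\<lambda>t. pmf (mu t) k)"
proof (induction k rule: less_induct)
  case (less k)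
  show ?case
  proof (cases k)
    case 0
    have "pmf (mu t) 0 = 1 - rho t" for t
      unfolding expectation_of_bool_0[symmetric] by (subst integral_measure_pmf[of "{0}"]) auto
    then show ?thesis
      unfolding convergent_def 0 using tendsto_diff[OF tendsto_const rho_tendsto] by auto
  next
    case (Suc m)
    define l where "l j = lim (\<lambda>t. pmf (mu t) j)" for j
    have l: "(\<lambda>t. pmf (mu t) j) \<longlonglongrightarrow> l j" if "j \<le> m" for j
      using less[of j] that Suc by (simp add: convergent_LIMSEQ_iff l_def)
    have "(\<lambda>t. exp (rho t) * (pmf (mu (Suc t)) m - pmf (mu t) 0 * pmf (pois (rho t)) m
        - (\<Sum>j<m. pmf (mu t) (Suc j) * pmf (pois (rho t)) (m - j)))) \<longlonglongrightarrow>
      exp (rho_of r) * (l m - l 0 * pmf (pois (rho_of r)) m - (\<Sum>j<m. l (Suc j) * pmf (pois (rho_of r)) (m - j)))"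
      by (intro tendsto_mult tendsto_diff tendsto_sum tendsto_exp rho_tendsto
          pmf_pois_tendsto[OF rho_tendsto rho_nonneg] LIMSEQ_Suc[OF l] l) auto
    then have "convergent (\<lambda>t. exp (rho t) * (pmf (mu (Suc t)) m - pmf (mu t) 0 * pmf (pois (rho t)) m
        - (\<Sum>j<m. pmf (mu t) (Suc j) * pmf (pois (rho t)) (m - j))))"
      by (rule convergentI)
    then show ?thesis
      unfolding Suc mu_Suc pmf_Suc_queue_step[OF rho_nonneg, symmetric] .
  qed
qed

lemma sum_pmf_mu_ge: "1 - r / real (Suc K) \<le> (\<Sum>k\<le>K. pmf (mu t) k)"
proof -
  have "measure_pmf.expectation (mu t) (\<lambda>x. 1 - real x / real (Suc K))
      \<le> measure_pmf.expectation (mu t) (\<lambda>x. of_bool (x \<le> K))"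
    by (intro integral_mono) (auto simp: field_simps)
  also have "measure_pmf.expectation (mu t) (\<lambda>x. of_bool (x \<le> K)) = (\<Sum>k\<le>K. pmf (mu t) k)"
    by (subst integral_measure_pmf[of "{..K}"]) auto
  finally show ?thesis using mean[of t] by (simp add: measure_pmf.prob_space)
qed

lemma pmf_mu_tendsto: "(\<lambda>t. pmf (mu t) k) \<longlonglongrightarrow> pmf (MD1_inv (rho_of r)) k"
proof -
  define c where "c k = lim (\<lambda>t. pmf (mu t) k)" for k
  have c: "(\<lambda>t. pmf (mu t) k) \<longlonglongrightarrow> c k" for k
    using pmf_mu_convergent by (simp add: convergent_LIMSEQ_iff c_def)
  have c_nonneg: "0 \<le> c k" for k
    by (rule LIMSEQ_le_const[OF c]) auto
  have lim: "(\<lambda>t. \<Sum>k\<le>K. pmf (mu t) k) \<longlonglongrightarrow> (\<Sum>k\<le>K. c k)" for K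
    by (intro tendsto_sum c)
  have "(\<lambda>K. \<Sum>k\<le>K. c k) \<longlonglongrightarrow> 1"
  proof (rule tendsto_sandwich)
    show "\<forall>\<^sub>F K in sequentially. 1 - r / real (Suc K) \<le> (\<Sum>k\<le>K. c k)"
      using sum_pmf_mu_ge by (intro always_eventually allI LIMSEQ_le_const[OF lim]) auto
    show "\<forall>\<^sub>F K in sequentially. (\<Sum>k\<le>K. c k) \<le> 1"
      by (intro always_eventually allI LIMSEQ_le_const2[OF lim])
        (auto simp flip: measure_measure_pmf_finite)
    have "(\<lambda>K. r / real (Suc K)) \<longlonglongrightarrow> 0"
      by (rule LIMSEQ_Suc[OF lim_const_over_n])
    then show "(\<lambda>K. 1 - r / real (Suc K)) \<longlonglongrightarrow> 1"
      using tendsto_diff[OF tendsto_const, of _ 0 _ 1] by simp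
  qed simp
  then have "c sums 1" by (simp add: sums_def_le)
  then have "(\<integral>\<^sup>+ k. ennreal (c k) \<partial>count_space UNIV) = 1"
    using suminf_ennreal_eq[of c 1, OF c_nonneg] by (simp add: nn_integral_count_space_nat)
  then have pmf_c: "pmf (embed_pmf c) k = c k" for k
    using c_nonneg by (simp add: pmf_embed_pmf)
  have "queue_step (rho_of r) (embed_pmf c) = embed_pmf c"
  proof (rule pmf_eqI)
    fix k
    have "(\<lambda>t. pmf (mu (Suc t)) k) \<longlonglongrightarrow> pmf (queue_step (rho_of r) (embed_pmf c)) k"
      unfolding mu_Suc pmf_queue_step pmf_c
      by (intro tendsto_intros c pmf_pois_tendsto[OF rho_tendsto rho_nonneg])
    then show "pmf (queue_step (rho_of r) (embed_pmf c)) k = pmf (embed_pmf c) k"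
      unfolding pmf_c using LIMSEQ_Suc[OF c[of k]] by (rule LIMSEQ_unique)
  qed
  then have "MD1_inv (rho_of r) = embed_pmf c"
    using rho_of_range r by (intro MD1_inv_eq) auto
  then show ?thesis using c by (simp add: pmf_c)
qed

end

theorem theorem2p5:
  fixes mu0 :: "nat pmf" and r :: real
  assumes "0 \<le> r" and "r < 1"
    and "integrable (measure_pmf mu0) real"
    and "measure_pmf.expectation mu0 real = r"
    and "\<exists>lam>0. integrable (measure_pmf mu0) (\<lambda>x. exp (lam * real x))"
  shows "weak_conv_m (\<lambda>t. distr (measure_pmf (nl_law mu0 t)) borel real)
                     (distr (measure_pmf (MD1_inv (rho_of r))) borel real)"
proof -
  obtain lam where lam: "0 < lam" "integrable (measure_pmf mu0) (\<lambda>x. exp (lam * real x))"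
    using assms(5) by blast
  obtain z where z: "1 < z" "z \<le> exp lam" "exp (r * (z - 1)) < z"
    using exists_drift_base[OF assms(1,2) lam(1)] by blast
  have "integrable (measure_pmf mu0) (\<lambda>x. z ^ x)"
  proof (rule Bochner_Integration.integrable_bound[OF lam(2)])
    have "z ^ x \<le> exp (lam * real x)" for x
      using power_mono[OF z(2), of x] z(1) by (simp add: exp_of_nat2_mult)
    then show "AE x in measure_pmf mu0. norm (z ^ x) \<le> norm (exp (lam * real x))"
      using z(1) by simp
  qed simp
  then interpret subcritical_nl_queue mu0 r z
    using assms z by unfold_locales
  show ?thesis by (intro weak_conv_m_pmf_nat pmf_mu_tendsto)
qed

end
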